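(* The radii of the classes $\mathcal{G}_1,\mathcal{G}_2,\mathcal{G}_3$ with respect to the class $\mathcal{S}_{SG}^*$ (starlike functions associated with the modified sigmoid function) are exactly: (i) $R_{\mathcal{S}_{SG}^{*}}(\mathcal{G}_1)= \dfrac{2(e-1)}{(6+6e)+\sqrt{40+64e+40e^2}}\approx 0.0766$; (ii) $R_{\mathcal{S}_{SG}^{*}}(\mathcal{G}_2)= \dfrac{2(e-1)}{(5+5e)+\sqrt{25+42e+33e^2}}\approx 0.0901$; (iii) $R_{\mathcal{S}_{SG}^{*}}(\mathcal{G}_3)= \dfrac{2(e-1)}{(4+4e)+\sqrt{20+24e+20e^2}}\approx 0.1140$.
   Context: $\mathbb{D}$ is the open unit disc in $\mathbb{C}$. $\mathcal{A}$ is the class of analytic functions $f$ on $\mathbb{D}$ with $f(0)=0$, $f'(0)=1$. $\mathcal{P}$ is the class of analytic functions $p$ on $\mathbb{D}$ with $p(0)=1$ and $\operatorname{Re}p(z)>0$ for all $z\in\mathbb{D}$; $\mathcal{P}(1/2)=\{p\in\mathcal{P}:\operatorname{Re}p(z)>1/2 \text{ for all } z\in\mathbb{D}\}$. Quotients below are understood with removable singularities filled in (in particular at $0$). Define $\mathcal{G}_1=\{f\in\mathcal{A}: f/g\in\mathcal{P}\text{ and } g/(zp)\in\mathcal{P}\text{ for some } g\in\mathcal{A},\ p\in\mathcal{P}\}$, $\mathcal{G}_2=\{f\in\mathcal{A}: f/g\in\mathcal{P}\text{ and } g/(zp)\in\mathcal{P}(1/2)\text{ for some } g\in\mathcal{A},\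 p\in\mathcal{P}\}$, $\mathcal{G}_3=\{f\in\mathcal{A}: f/(zp)\in\mathcal{P}\text{ for some } p\in\mathcal{P}\}$. For subclasses $\mathcal{F},\mathcal{G}$ of $\mathcal{A}$, the $\mathcal{G}$-radius $R_{\mathcal{G}}(\mathcal{F})$ of $\mathcal{F}$ is the largest number $R\in(0,1)$ such that, for every $f\in\mathcal{F}$ and every $0<r<R$, the function $z\mapsto r^{-1}f(rz)$ belongs to $\mathcal{G}$. For analytic $f,g$ on $\mathbb{D}$, $f\prec g$ ($f$ is subordinate to $g$) means $f=g\circ w$ for some analytic $w:\mathbb{D}\to\mathbb{D}$ with $w(0)=0$. For an analytic univalent $\varphi$ on $\mathbb{D}$ with $\varphi(0)=1$, $\mathcal{S}^*(\varphi)=\{f\in\mathcal{A}: zf'(z)/f(z)\prec\varphi(z)\}$. $\mathcal{S}_{SG}^*=\mathcal{S}^*\left(\dfrac{2}{1+e^{-z}}\right)$; the function $2/(1+e^{-z})$ maps $\mathbb{D}$ onto $\{w\in\mathbb{C}:|\log(w/(2-w))|<1\}$. *)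

theory Defs
  imports "HOL-Complex_Analysis.Complex_Analysis"
begin

text \<open>
  Functions on the open unit disc are total functions on \<^typ>\<open>complex\<close>; all notions below depend only
  on their values on \<^term>\<open>ball 0 1 :: complex set\<close>.
\<close>

abbreviation unit_disc :: "complex set" (\<open>\<D>\<close>)
  where "\<D> \<equiv> ball 0 1"

definition class_A :: "(complex \<Rightarrow> complex) set"
  where "class_A = {f. f holomorphic_on \<D> \<and> f 0 = 0 \<and> deriv f 0 = 1}"

definition class_P :: "(complex \<Rightarrow> complex) set"
  where "class_P = {p. p holomorphic_on \<D> \<and> p 0 = 1 \<and> (\<forall>z\<in>\<D>. Re (p z) > 0)}"

definition class_P_half :: "(complex \<Rightarrow> complex) set"
  where "class_P_half = {p \<in> class_P. \<forall>z\<in>\<D>. Re (p z) > 1 / 2}"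

text \<open>
  Pointwise quotient with removable singularities filled in. At a pole \<^const>\<open>remove_sings\<close> returns \<open>0\<close>,
  so the result is then not continuous there and in particular not holomorphic.
\<close>

definition fquot :: "(complex \<Rightarrow> complex) \<Rightarrow> (complex \<Rightarrow> complex) \<Rightarrow> complex \<Rightarrow> complex"
  where "fquot f g = remove_sings (\<lambda>z. f z / g z)"

definition class_G1 :: "(complex \<Rightarrow> complex) set"
  where "class_G1 = {f \<in> class_A. \<exists>g\<in>class_A. \<exists>p\<in>class_P.
           fquot f g \<in> class_P \<and> fquot g (\<lambda>z. z * p z) \<in> class_P}"

definition class_G2 :: "(complex \<Rightarrow> complex) set"
  where "class_G2 = {f \<in> class_A. \<exists>g\<in>class_A. \<exists>p\<in>class_P.
           fquot f g \<in> class_P \<and> fquot g (\<lambda>z. z * p z) \<in> class_P_half}"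

definition class_G3 :: "(complex \<Rightarrow> complex) set"
  where "class_G3 = {f \<in> class_A. \<exists>p\<in>class_P. fquot f (\<lambda>z. z * p z) \<in> class_P}"

definition subordinate :: "(complex \<Rightarrow> complex) \<Rightarrow> (complex \<Rightarrow> complex) \<Rightarrow> bool" (infix \<open>\<prec>\<^sub>s\<close> 50)
  where "f \<prec>\<^sub>s g \<longleftrightarrow> f holomorphic_on \<D> \<and> g holomorphic_on \<D> \<and>
           (\<exists>w. w holomorphic_on \<D> \<and> w ` \<D> \<subseteq> \<D> \<and> w 0 = 0 \<and> (\<forall>z\<in>\<D>. f z = g (w z)))"

definition starlike_class :: "(complex \<Rightarrow> complex) \<Rightarrow> (complex \<Rightarrow> complex) set"
  where "starlike_class \<phi> = {f \<in> class_A. fquot (\<lambda>z. z * deriv f z) f \<prec>\<^sub>s \<phi>}"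

definition modified_sigmoid :: "complex \<Rightarrow> complex"
  where "modified_sigmoid z = 2 / (1 + exp (- z))"

definition class_SG :: "(complex \<Rightarrow> complex) set"
  where "class_SG = starlike_class modified_sigmoid"

definition radius_admissible ::
    "(complex \<Rightarrow> complex) set \<Rightarrow> (complex \<Rightarrow> complex) set \<Rightarrow> real set"
  where "radius_admissible \<G> \<F> = {R. 0 < R \<and> R < 1 \<and>
           (\<forall>f\<in>\<F>. \<forall>r. 0 < r \<and> r < R \<longrightarrow>
              (\<lambda>z. inverse (of_real r) * f (of_real r * z)) \<in> \<G>)}"

text \<open>
  A relation rather than a (choice-valued) function, so that the assertion includes the existence of a
  largest admissible number.
\<close>

definition is_radius ::
    "(complex \<Rightarrow> complex) set \<Rightarrow> (complex \<Rightarrow> complex) set \<Rightarrow> real \<Rightarrow> bool"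
  where "is_radius \<G> \<F> R \<longleftrightarrow>
           R \<in> radius_admissible \<G> \<F> \<and> (\<forall>R'\<in>radius_admissible \<G> \<F>. R' \<le> R)"

end

theory Submission
  imports Defs
begin

text \<open>
  Members of the three classes are products. Clearing the quotients, \<open>f\<close> lies in \<open>\<G>\<^sub>1\<close> or
  \<open>\<G>\<^sub>2\<close> iff \<open>f(z) = z p(z) q(z) s(z)\<close> on the disc with \<open>p, q\<close> of positive real part and \<open>s\<close>
  of positive real part, respectively of real part above \<open>1/2\<close>; for \<open>\<G>\<^sub>3\<close> the factor \<open>s\<close> is \<open>1\<close>.
  All factors take the value \<open>1\<close> at the origin.
  Hence \<open>z f'/f - 1\<close> is the sum of the \<open>z p'/p\<close> of the factors.

  The Schwarz-Pick inequality (\<open>Schwarz_Pick_deriv\<close>) bounds each term on \<open>|z| = r\<close>: by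
  \<open>2r/(1-r\<^sup>2)\<close> for positive real part (\<open>norm_zlogderiv_class_P\<close>), and by \<open>r/(1-r)\<close> for real
  part above \<open>1/2\<close> (\<open>norm_zlogderiv_class_P_half\<close>). Both bounds are attained at the point \<open>z = r\<close>,
  by \<open>(1+z)/(1-z)\<close> and \<open>1/(1-z)\<close>, so the corresponding product attains the total bound there,
  with a positive real value.

  Put \<open>\<rho> = (e-1)/(e+1)\<close>. The disc of radius \<open>\<rho>\<close> about \<open>1\<close> lies in the image of the modified sigmoid
  (\<open>subordinate_modified_sigmoidI\<close>), because the inverse of the sigmoid is
  \<open>1 + u \<mapsto> log ((1+u)/(1-u))\<close>, whose Taylor coefficients are nonnegative and whose value at
  \<open>u = \<rho>\<close> is \<open>1\<close>. The point \<open>1 + \<rho>\<close> itself, the sigmoid at \<open>1\<close>, is not in the image of the open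
  disc (\<open>subordinate_modified_sigmoid_neq\<close>). So the radius is the \<open>R\<close> at which the total bound
  reaches \<open>\<rho>\<close> (\<open>is_radius_class_SG\<close>): below \<open>R\<close> the values of \<open>z f'/f\<close> stay in the disc, while a
  dilation of the extremal product by any \<open>r > R\<close> takes the forbidden value \<open>1 + \<rho>\<close> inside the unit disc.
  In each case the equation for \<open>R\<close> is quadratic, and its positive root is the stated number.
\<close>

section \<open>Quotients with a removable singularity at the origin\<close>

text \<open>
  A denominator vanishing at most at the origin keeps all singularities of the quotient there; the
  denominators \<open>z p\<close> with \<open>p\<close> of positive real part are of this kind.
\<close>

lemma fquot_eqI:
  assumes q: "q holomorphic_on \<D>" and fg: "\<And>z. z \<in> \<D> \<Longrightarrow> f z = q z * g z"
    and g: "\<And>z. z \<in> \<D> \<Longrightarrow> z \<noteq> 0 \<Longrightarrow> g z \<noteq> 0" and z: "z \<in> \<D>"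
  shows "fquot f g z = q z"
proof -
  have "eventually (\<lambda>x. x \<in> \<D> - {0}) (at z)"
  proof (cases "z = 0")
    case True
    then show ?thesis
      using eventually_at_in_open[of \<D> z] z by simp
  next
    case False
    then show ?thesis
      using eventually_at_in_open'[of "\<D> - {0}" z] z by (simp add: open_delete)
  qed
  then have "eventually (\<lambda>x. f x / g x = q x) (at z)"
    by eventually_elim (use fg g in auto)
  then have "fquot f g z = remove_sings q z"
    unfolding fquot_def by (rule remove_sings_cong) simp
  also have "\<dots> = q z"
    using q z by (intro remove_sings_at_analytic) (auto simp: analytic_at intro!: exI[of _ \<D>])
  finally show ?thesis .
qed

text \<open>Off the origin the quotient is analytic; the value at the origin follows by the identity theorem.\<close>

lemma fquot_mult:
  assumes f: "f holomorphic_on \<D>" and hg: "g holomorphic_on \<D>"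
    and q: "fquot f g holomorphic_on \<D>"
    and g: "\<And>z. z \<in> \<D> \<Longrightarrow> z \<noteq> 0 \<Longrightarrow> g z \<noteq> 0" and z: "z \<in> \<D>"
  shows "f z = fquot f g z * g z"
proof (rule analytic_continuation_open[of "\<D> - {0}" \<D> f])
  show "open (\<D> - {0})" by (simp add: open_delete)
  have "(1/2::complex) \<in> \<D> - {0}" by simp
  then show "\<D> - {0} \<noteq> {}" by blast
  show "(\<lambda>z. fquot f g z * g z) holomorphic_on \<D>"
    using q hg by (intro holomorphic_intros)
  fix x assume x: "x \<in> \<D> - {0}"
  have "(\<lambda>z. f z / g z) analytic_on {x}"
    using x f hg g
    by (intro analytic_intros) (auto simp: analytic_at intro!: exI[of _ \<D>])
  then have "fquot f g x = f x / g x"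
    unfolding fquot_def by simp
  then show "f x = fquot f g x * g x"
    using x g by simp
qed (use f z in auto)

lemma class_AI:
  assumes h: "h holomorphic_on \<D>" "h 0 = 1" and f: "\<And>z. z \<in> \<D> \<Longrightarrow> f z = z * h z"
  shows "f \<in> class_A"
proof -
  have "f holomorphic_on \<D>"
    by (rule holomorphic_transform[of "\<lambda>z. z * h z"]) (use f h in \<open>auto intro!: holomorphic_intros\<close>)
  moreover have "(f has_field_derivative 1) (at 0)"
  proof -
    have "(h has_field_derivative deriv h 0) (at 0)"
      using h holomorphic_derivI[of h \<D> 0] by simp
    then have "((\<lambda>z. z * h z) has_field_derivative 1) (at 0)"
      by (auto intro!: derivative_eq_intros simp: h)
    then show ?thesis
      by (rule has_field_derivative_transform_within_open[of _ _ _ \<D>]) (use f in auto)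
  qed
  ultimately show ?thesis
    using f[of 0] by (simp add: class_A_def DERIV_imp_deriv)
qed

lemma class_P_D:
  assumes "p \<in> class_P"
  shows "p holomorphic_on \<D>" "p 0 = 1" "\<And>z. z \<in> \<D> \<Longrightarrow> Re (p z) > 0" "\<And>z. z \<in> \<D> \<Longrightarrow> p z \<noteq> 0"
  using assms by (force simp: class_P_def)+

lemma class_P_cong:
  assumes "p \<in> class_P" "\<And>z. z \<in> \<D> \<Longrightarrow> q z = p z"
  shows "q \<in> class_P"
  using assms holomorphic_cong[OF refl, of \<D> q p] by (auto simp: class_P_def)

lemma class_P_half_subset: "class_P_half \<subseteq> class_P"
  by (auto simp: class_P_half_def)

lemma class_P_half_cong:
  assumes "p \<in> class_P_half" "\<And>z. z \<in> \<D> \<Longrightarrow> q z = p z"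
  shows "q \<in> class_P_half"
  using assms class_P_cong by (auto simp: class_P_half_def)

lemma fquot_mem_iff:
  assumes Q: "Q \<subseteq> class_P" and cong: "\<And>p q. p \<in> Q \<Longrightarrow> (\<And>z. z \<in> \<D> \<Longrightarrow> q z = p z) \<Longrightarrow> q \<in> Q"
    and f: "f holomorphic_on \<D>" and hg: "g holomorphic_on \<D>"
    and g: "\<And>z. z \<in> \<D> \<Longrightarrow> z \<noteq> 0 \<Longrightarrow> g z \<noteq> 0"
  shows "fquot f g \<in> Q \<longleftrightarrow> (\<exists>q\<in>Q. \<forall>z\<in>\<D>. f z = q z * g z)"
proof
  assume "fquot f g \<in> Q"
  moreover from this have "fquot f g holomorphic_on \<D>"
    using Q class_P_D(1) by blast
  ultimately show "\<exists>q\<in>Q. \<forall>z\<in>\<D>. f z = q z * g z"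
    using fquot_mult[OF f hg _ g] by blast
next
  assume "\<exists>q\<in>Q. \<forall>z\<in>\<D>. f z = q z * g z"
  then obtain q where q: "q \<in> Q" "\<And>z. z \<in> \<D> \<Longrightarrow> f z = q z * g z" by blast
  then have "q holomorphic_on \<D>"
    using Q class_P_D(1) by blast
  then have "fquot f g z = q z" if "z \<in> \<D>" for z
    using that q g by (intro fquot_eqI)
  then show "fquot f g \<in> Q"
    using cong q(1) by blast
qed

section \<open>Products of functions with positive real part\<close>

text \<open>
  The denominators have to be cleared from the inside out: \<open>z p\<close> vanishes only at the origin, which
  gives \<open>g = z p s\<close>; hence \<open>g\<close> vanishes only at the origin as well, and \<open>f/g\<close> can be treated in the same way.
\<close>

lemma two_quotients_iff:
  assumes Q: "Q \<subseteq> class_P" and cong: "\<And>p q. p \<in> Q \<Longrightarrow> (\<And>z. z \<in> \<D> \<Longrightarrow> q z = p z) \<Longrightarrow> q \<in> Q"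
  shows "(f \<in> class_A \<and> (\<exists>g\<in>class_A. \<exists>p\<in>class_P.
             fquot f g \<in> class_P \<and> fquot g (\<lambda>z. z * p z) \<in> Q)) \<longleftrightarrow>
         (\<exists>p\<in>class_P. \<exists>q\<in>class_P. \<exists>s\<in>Q. \<forall>z\<in>\<D>. f z = z * (p z * q z * s z))"
    (is "?L \<longleftrightarrow> ?R")
proof
  assume ?L
  then obtain g p where f: "f \<in> class_A" and g: "g \<in> class_A" and p: "p \<in> class_P"
    and fg: "fquot f g \<in> class_P" and gp: "fquot g (\<lambda>z. z * p z) \<in> Q" by blast
  have "\<exists>s\<in>Q. \<forall>z\<in>\<D>. g z = s z * (z * p z)"
    using gp
    by (subst (asm) fquot_mem_iff[OF Q cong])
       (use g class_P_D[OF p] in \<open>auto simp: class_A_def intro!: holomorphic_intros\<close>)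
  then obtain s where s: "s \<in> Q" "\<And>z. z \<in> \<D> \<Longrightarrow> g z = s z * (z * p z)" by blast
  have sP: "s \<in> class_P" using s Q by blast
  have "\<exists>q\<in>class_P. \<forall>z\<in>\<D>. f z = q z * g z"
    using fg
    by (subst (asm) fquot_mem_iff[OF order.refl class_P_cong])
       (use f g s class_P_D[OF p] class_P_D[OF sP] in \<open>auto simp: class_A_def\<close>)
  then obtain q where q: "q \<in> class_P" "\<And>z. z \<in> \<D> \<Longrightarrow> f z = q z * g z" by blast
  have "\<forall>z\<in>\<D>. f z = z * (p z * q z * s z)"
    using q s by (simp add: mult_ac)
  then show ?R using p q s by blast
next
  assume ?R
  then obtain p q s where p: "p \<in> class_P" and q: "q \<in> class_P" and s: "s \<in> Q"
    and f: "\<And>z. z \<in> \<D> \<Longrightarrow> f z = z * (p z * q z * s z)" by blast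
  have sP: "s \<in> class_P" using s Q by blast
  note P = class_P_D[OF p] class_P_D[OF q] class_P_D[OF sP]
  define g where "g = (\<lambda>z. z * (p z * s z))"
  have fA: "f \<in> class_A"
    using P f by (intro class_AI[of "\<lambda>z. p z * q z * s z"]) (auto intro!: holomorphic_intros)
  have gA: "g \<in> class_A"
    using P by (intro class_AI[of "\<lambda>z. p z * s z"]) (auto simp: g_def intro!: holomorphic_intros)
  have "fquot f g \<in> class_P"
    by (subst fquot_mem_iff[OF order.refl class_P_cong])
       (use P f fA gA q in \<open>auto simp: g_def class_A_def intro!: bexI[of _ q]\<close>)
  moreover have "fquot g (\<lambda>z. z * p z) \<in> Q"
    by (subst fquot_mem_iff[OF Q cong])
       (use P gA s in \<open>auto simp: g_def class_A_def intro!: bexI[of _ s] holomorphic_intros\<close>)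
  ultimately show ?L
    using fA gA p by blast
qed

lemma class_G1_iff:
  "f \<in> class_G1 \<longleftrightarrow>
    (\<exists>p\<in>class_P. \<exists>q\<in>class_P. \<exists>s\<in>class_P. \<forall>z\<in>\<D>. f z = z * (p z * q z * s z))"
  unfolding class_G1_def mem_Collect_eq
  by (rule two_quotients_iff) (auto intro: class_P_cong)

lemma class_G2_iff:
  "f \<in> class_G2 \<longleftrightarrow>
    (\<exists>p\<in>class_P. \<exists>q\<in>class_P. \<exists>s\<in>class_P_half. \<forall>z\<in>\<D>. f z = z * (p z * q z * s z))"
  unfolding class_G2_def mem_Collect_eq
  by (rule two_quotients_iff[OF class_P_half_subset class_P_half_cong])

lemma class_G3_iff:
  "f \<in> class_G3 \<longleftrightarrow> (\<exists>p\<in>class_P. \<exists>q\<in>class_P. \<forall>z\<in>\<D>. f z = z * (p z * q z))"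
proof
  assume "f \<in> class_G3"
  then obtain p where f: "f \<in> class_A" and p: "p \<in> class_P"
    and fp: "fquot f (\<lambda>z. z * p z) \<in> class_P" by (auto simp: class_G3_def)
  have "\<exists>q\<in>class_P. \<forall>z\<in>\<D>. f z = q z * (z * p z)"
    using fp
    by (subst (asm) fquot_mem_iff[OF order.refl class_P_cong])
       (use f class_P_D[OF p] in \<open>auto simp: class_A_def intro!: holomorphic_intros\<close>)
  then show "\<exists>p\<in>class_P. \<exists>q\<in>class_P. \<forall>z\<in>\<D>. f z = z * (p z * q z)"
    using p by (auto simp: mult_ac)
next
  assume "\<exists>p\<in>class_P. \<exists>q\<in>class_P. \<forall>z\<in>\<D>. f z = z * (p z * q z)"
  then obtain p q where p: "p \<in> class_P" and q: "q \<in> class_P"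
    and f: "\<And>z. z \<in> \<D> \<Longrightarrow> f z = z * (p z * q z)" by blast
  note P = class_P_D[OF p] class_P_D[OF q]
  have fA: "f \<in> class_A"
    using P f by (intro class_AI[of "\<lambda>z. p z * q z"]) (auto intro!: holomorphic_intros)
  moreover have "fquot f (\<lambda>z. z * p z) \<in> class_P"
    by (subst fquot_mem_iff[OF order.refl class_P_cong])
       (use P f fA q in \<open>auto simp: class_A_def intro!: bexI[of _ q] holomorphic_intros\<close>)
  ultimately show "f \<in> class_G3"
    using p by (auto simp: class_G3_def)
qed

section \<open>Logarithmic derivatives\<close>

text \<open>The logarithmic derivative with respect to \<open>log z\<close>, which turns products into sums.\<close>

definition zlogderiv :: "(complex \<Rightarrow> complex) \<Rightarrow> complex \<Rightarrow> complex"
  where "zlogderiv h z = z * deriv h z / h z"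

lemma zlogderiv_mult:
  assumes "p holomorphic_on \<D>" "q holomorphic_on \<D>" "p z \<noteq> 0" "q z \<noteq> 0" "z \<in> \<D>"
  shows "zlogderiv (\<lambda>z. p z * q z) z = zlogderiv p z + zlogderiv q z"
proof -
  have "p field_differentiable at z" "q field_differentiable at z"
    using assms by (auto intro: holomorphic_on_imp_differentiable_at)
  then have "deriv (\<lambda>z. p z * q z) z = p z * deriv q z + deriv p z * q z"
    by simp
  then show ?thesis
    using assms by (simp add: zlogderiv_def field_simps)
qed

lemma fquot_deriv_eq_zlogderiv:
  assumes h: "h holomorphic_on \<D>" "\<And>z. z \<in> \<D> \<Longrightarrow> h z \<noteq> 0"
    and f: "\<And>z. z \<in> \<D> \<Longrightarrow> f z = z * h z" and z: "z \<in> \<D>"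
  shows "fquot (\<lambda>z. z * deriv f z) f z = 1 + zlogderiv h z"
proof (rule fquot_eqI[OF _ _ _ z])
  show "(\<lambda>z. 1 + zlogderiv h z) holomorphic_on \<D>"
    unfolding zlogderiv_def using h by (intro holomorphic_intros) auto
  fix x :: complex assume x: "x \<in> \<D>"
  have "(h has_field_derivative deriv h x) (at x)"
    using h x holomorphic_derivI[of h \<D> x] by simp
  then have "((\<lambda>z. z * h z) has_field_derivative h x + x * deriv h x) (at x)"
    by (auto intro!: derivative_eq_intros)
  then have "(f has_field_derivative h x + x * deriv h x) (at x)"
    by (rule has_field_derivative_transform_within_open[of _ _ _ \<D>]) (use f x in auto)
  then have "deriv f x = h x + x * deriv h x"
    by (rule DERIV_imp_deriv)
  then show "x * deriv f x = (1 + zlogderiv h x) * f x"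
    using h x f by (simp add: zlogderiv_def field_simps)
qed (use h f in auto)

text \<open>
  Disc automorphisms moving \<open>0\<close> to \<open>a\<close> and \<open>w a\<close> to \<open>0\<close> reduce this to the derivative bound of the
  Schwarz lemma at the origin.
\<close>

lemma Schwarz_Pick_deriv:
  assumes w: "w holomorphic_on \<D>" and wD: "w ` \<D> \<subseteq> \<D>" and a: "a \<in> \<D>"
  shows "norm (deriv w a) * (1 - (norm a)\<^sup>2) \<le> 1 - (norm (w a))\<^sup>2"
proof -
  define b where "b = w a"
  have b: "b \<in> \<D>" using wD imageI[OF a, of w] by (auto simp: b_def)
  have sq: "1 - cnj c * c = of_real (1 - (norm c)\<^sup>2)" for c :: complex
    unfolding of_real_diff of_real_1 complex_norm_square by (simp add: mult.commute)
  have pos: "1 - (norm c)\<^sup>2 > 0" if "c \<in> \<D>" for c :: complex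
    using that by (simp add: power_less_one_iff abs_square_less_1)
  define M where "M = Moebius_function 0 (-a)"
  define N where "N = Moebius_function 0 b"
  define u where "u = (\<lambda>z. N (w (M z)))"
  have M0: "M 0 = a" by (simp add: M_def Moebius_function_def)
  have MD: "M z \<in> \<D>" if "z \<in> \<D>" for z
    using that a by (simp add: M_def Moebius_function_norm_lt_1)
  have holM: "M holomorphic_on \<D>"
    unfolding M_def using a by (intro Moebius_function_holomorphic) auto
  have holN: "N holomorphic_on \<D>"
    unfolding N_def using b by (intro Moebius_function_holomorphic) auto
  have hol: "u holomorphic_on \<D>"
    using holomorphic_on_compose_gen[OF holomorphic_on_compose_gen[OF holM w] holN] MD wD
    unfolding u_def o_def by (auto simp: image_subset_iff)
  have u0: "u 0 = 0"
    using M0 by (simp add: u_def N_def Moebius_function_def b_def)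
  have uD: "norm (u z) < 1" if "norm z < 1" for z
    using MD[of z] wD b that unfolding u_def N_def
    by (intro Moebius_function_norm_lt_1) (auto simp: image_subset_iff)
  have "norm (deriv u 0) \<le> 1"
    using Schwarz_Lemma(2)[OF hol u0 uD, of 0] by simp
  moreover have "(u has_field_derivative
      (1 / of_real (1 - (norm b)\<^sup>2) * (deriv w a * of_real (1 - (norm a)\<^sup>2)))) (at 0)"
  proof -
    have dM: "(M has_field_derivative of_real (1 - (norm a)\<^sup>2)) (at 0)"
      unfolding M_def Moebius_function_def sq[symmetric]
      by (auto intro!: derivative_eq_intros)
    have dw: "(w has_field_derivative deriv w a) (at (M 0))"
      using w a M0 holomorphic_derivI[of w \<D> a] by simp
    have nz: "1 - cnj b * b \<noteq> 0"
      using pos[OF b] unfolding sq by (metis less_irrefl of_real_eq_0_iff)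
    have dN: "(N has_field_derivative 1 / of_real (1 - (norm b)\<^sup>2)) (at (w (M 0)))"
      unfolding N_def Moebius_function_def M0 b_def[symmetric] sq[symmetric]
      by (rule derivative_eq_intros refl nz | use nz in \<open>simp add: divide_simps\<close>)+
    show ?thesis
      unfolding u_def
      by (rule DERIV_chain2[where f = N and g = "\<lambda>z. w (M z)", OF dN
            DERIV_chain2[where f = w and g = M, OF dw dM]])
  qed
  ultimately have "norm (1 / complex_of_real (1 - (norm b)\<^sup>2) * (deriv w a * of_real (1 - (norm a)\<^sup>2))) \<le> 1"
    by (simp only: DERIV_imp_deriv)
  then have "norm (deriv w a) * (1 - (norm a)\<^sup>2) / (1 - (norm b)\<^sup>2) \<le> 1"
    using pos[OF b] pos[OF a] by (simp only: norm_mult norm_divide norm_of_real) simp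
  then show ?thesis
    using pos[OF b] by (simp add: b_def divide_simps)
qed

text \<open>
  The Cayley transform \<open>w = (p - 1)/(p + 1)\<close> maps the disc to itself, and \<open>p'/p = 2w'/(1 - w\<^sup>2)\<close>. The
  factor \<open>1 - |w|\<^sup>2\<close> from Schwarz-Pick cancels against \<open>|1 - w\<^sup>2|\<close>.
\<close>

lemma norm_zlogderiv_class_P:
  assumes p: "p \<in> class_P" and z: "z \<in> \<D>"
  shows "norm (zlogderiv p z) \<le> 2 * norm z / (1 - (norm z)\<^sup>2)"
proof -
  note P = class_P_D[OF p]
  define w where "w = (\<lambda>z. (p z - 1) / (p z + 1))"
  have nz: "p x + 1 \<noteq> 0" if "x \<in> \<D>" for x
    using P(3)[OF that] by (auto simp: complex_eq_iff)
  have hol: "w holomorphic_on \<D>"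
    unfolding w_def using P nz by (intro holomorphic_intros) auto
  have wD: "w x \<in> \<D>" if "x \<in> \<D>" for x
  proof -
    have "(norm (p x - 1))\<^sup>2 < (norm (p x + 1))\<^sup>2"
      using P(3)[OF that] unfolding cmod_power2 by (simp add: power2_eq_square algebra_simps)
    then have "norm (p x - 1) < norm (p x + 1)"
      by (rule power2_less_imp_less) simp
    then show ?thesis
      using nz[OF that] by (simp add: w_def norm_divide)
  qed
  have dp: "(p has_field_derivative deriv p z) (at z)"
    using P z holomorphic_derivI[of p \<D> z] by simp
  have dw: "deriv w z = 2 * deriv p z / (p z + 1)\<^sup>2"
    unfolding w_def using dp nz[OF z]
    by (intro DERIV_imp_deriv)
       (auto intro!: derivative_eq_intros simp: power2_eq_square field_simps)
  have w2: "1 - (w z)\<^sup>2 = 4 * p z / (p z + 1)\<^sup>2"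
    using nz[OF z]
    by (simp add: w_def power_divide divide_simps) (simp add: power2_eq_square algebra_simps)
  have eq: "deriv p z / p z = 2 * deriv w z / (1 - (w z)\<^sup>2)"
    unfolding dw w2 using nz[OF z] P(4)[OF z] by (simp add: field_simps)
  have pos: "1 - (norm z)\<^sup>2 > 0" using z by (simp add: abs_square_less_1)
  have posw: "1 - (norm (w z))\<^sup>2 > 0" using wD[OF z] by (simp add: abs_square_less_1)
  have tri: "1 - (norm (w z))\<^sup>2 \<le> norm (1 - (w z)\<^sup>2)"
    using norm_triangle_ineq2[of 1 "(w z)\<^sup>2"] by (simp add: norm_power)
  have "norm (deriv w z) * (1 - (norm z)\<^sup>2) \<le> 1 - (norm (w z))\<^sup>2"
    using Schwarz_Pick_deriv[OF hol _ z] wD by blast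
  also note tri
  finally have "norm (deriv w z) / norm (1 - (w z)\<^sup>2) \<le> 1 / (1 - (norm z)\<^sup>2)"
    using pos posw tri by (simp add: divide_simps)
  then have "2 * norm z * (norm (deriv w z) / norm (1 - (w z)\<^sup>2)) \<le> 2 * norm z * (1 / (1 - (norm z)\<^sup>2))"
    by (intro mult_left_mono) auto
  moreover have "zlogderiv p z = z * (2 * deriv w z / (1 - (w z)\<^sup>2))"
    unfolding zlogderiv_def using eq by (metis times_divide_eq_right)
  then have "norm (zlogderiv p z) = 2 * norm z * (norm (deriv w z) / norm (1 - (w z)\<^sup>2))"
    by (simp add: norm_mult norm_divide)
  ultimately show ?thesis by simp
qed

text \<open>
  Now \<open>w = 1 - 1/p\<close> maps the disc to itself, and \<open>p'/p = w'/(1 - w)\<close>. Schwarz-Pick leaves the factor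
  \<open>1 + |w|\<close>, which the Schwarz lemma bounds by \<open>1 + |z|\<close>; this cancels one factor of \<open>1 - |z|\<^sup>2\<close>.
\<close>

lemma norm_zlogderiv_class_P_half:
  assumes p: "p \<in> class_P_half" and z: "z \<in> \<D>"
  shows "norm (zlogderiv p z) \<le> norm z / (1 - norm z)"
proof -
  have P: "p holomorphic_on \<D>" "p 0 = 1" "\<And>x. x \<in> \<D> \<Longrightarrow> Re (p x) > 1/2" "\<And>x. x \<in> \<D> \<Longrightarrow> p x \<noteq> 0"
    using p class_P_D[of p] by (auto simp: class_P_half_def)
  define w where "w = (\<lambda>z. (p z - 1) / p z)"
  have hol: "w holomorphic_on \<D>"
    unfolding w_def using P by (intro holomorphic_intros) auto
  have wD: "norm (w x) < 1" if "norm x < 1" for x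
  proof -
    have x: "x \<in> \<D>" using that by simp
    have "(norm (p x - 1))\<^sup>2 < (norm (p x))\<^sup>2"
      using P(3)[OF x] unfolding cmod_power2 by (simp add: power2_eq_square algebra_simps)
    then have "norm (p x - 1) < norm (p x)"
      by (rule power2_less_imp_less) simp
    then show ?thesis
      using P(4)[OF x] by (simp add: w_def norm_divide)
  qed
  have w0: "w 0 = 0" by (simp add: w_def P)
  have wz: "norm (w z) \<le> norm z"
    using Schwarz_Lemma(1)[OF hol w0 wD] z by simp
  have dp: "(p has_field_derivative deriv p z) (at z)"
    using P z holomorphic_derivI[of p \<D> z] by simp
  have dw: "deriv w z = deriv p z / (p z)\<^sup>2"
    unfolding w_def using dp P(4)[OF z]
    by (intro DERIV_imp_deriv)
       (auto intro!: derivative_eq_intros simp: power2_eq_square field_simps)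
  have w1: "1 - w z = 1 / p z"
    using P(4)[OF z] by (simp add: w_def field_simps)
  have eq: "zlogderiv p z = z * (deriv w z / (1 - w z))"
    unfolding dw w1 zlogderiv_def using P(4)[OF z] by (simp add: field_simps power2_eq_square)
  have r: "norm z < 1" using z by simp
  have pos: "1 - (norm z)\<^sup>2 > 0" using z by (simp add: abs_square_less_1)
  have tri: "1 - norm (w z) \<le> norm (1 - w z)"
    using norm_triangle_ineq2[of 1 "w z"] by simp
  have "norm (deriv w z) * (1 - (norm z)\<^sup>2) \<le> 1 - (norm (w z))\<^sup>2"
    using Schwarz_Pick_deriv[OF hol _ z] wD by (simp add: image_subset_iff)
  also have "\<dots> = (1 - norm (w z)) * (1 + norm (w z))"
    by (simp add: power2_eq_square algebra_simps)
  also have "\<dots> \<le> norm (1 - w z) * (1 + norm z)"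
    using tri wz r by (intro mult_mono) auto
  finally have "norm (deriv w z) * (1 - norm z) * (1 + norm z) \<le> norm (1 - w z) * (1 + norm z)"
    by (simp add: power2_eq_square algebra_simps)
  then have "norm (deriv w z) * (1 - norm z) \<le> norm (1 - w z)"
    by (rule mult_right_le_imp_le) (simp add: add_pos_nonneg)
  moreover have "norm (1 - w z) > 0"
    using tri wz r by linarith
  ultimately have "norm (deriv w z) / norm (1 - w z) \<le> 1 / (1 - norm z)"
    using r by (simp add: divide_simps mult.commute)
  then have "norm z * (norm (deriv w z) / norm (1 - w z)) \<le> norm z * (1 / (1 - norm z))"
    by (intro mult_left_mono) auto
  then show ?thesis
    unfolding eq by (simp add: norm_mult norm_divide)
qed

section \<open>The modified sigmoid\<close>

lemma modified_sigmoid_holomorphic: "modified_sigmoid holomorphic_on \<D>"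
proof -
  have "1 + exp (- z) \<noteq> 0" if "z \<in> \<D>" for z :: complex
  proof -
    \<comment> \<open>\<open>exp (- z)\<close> stays in the right half-plane because \<open>1 < \<pi>/2\<close>.\<close>
    have "\<bar>Im z\<bar> < 1"
      using that abs_Im_le_cmod[of z] by simp
    then have "cos (Im z) > 0"
      using pi_gt3 by (intro cos_gt_zero_pi) auto
    then have "Re (1 + exp (- z)) > 0"
      by (simp add: Re_exp add_pos_pos)
    then show ?thesis by (metis less_irrefl zero_complex.sel(1))
  qed
  then show ?thesis
    unfolding modified_sigmoid_def by (intro holomorphic_intros) auto
qed

text \<open>
  The power series \<open>\<Sum> (1 - (-1)\<^sup>n) u\<^sup>n / n\<close> of the left-hand logarithms has nonnegative coefficients, so its
  modulus is largest on the positive axis.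
\<close>

lemma norm_Ln_diff_le:
  fixes u :: complex
  assumes u: "norm u < 1"
  shows "norm (Ln (1 + u) - Ln (1 - u)) \<le> ln (1 + norm u) - ln (1 - norm u)"
proof -
  define r where "r = norm u"
  have c: "(\<lambda>n. (u ^ n - (- u) ^ n) / of_nat n) sums (Ln (1 + u) - Ln (1 - u))"
    using sums_diff[OF Ln_series'[of u] Ln_series'[of "- u"]] u
    by (simp add: diff_divide_distrib)
  have d: "(\<lambda>n. (r ^ n - (- r) ^ n) / of_nat n) sums (ln (1 + r) - ln (1 - r))"
    using sums_diff[OF ln_series'[of r] ln_series'[of "- r"]] u
    by (simp add: diff_divide_distrib r_def)
  have "norm ((u ^ n - (- u) ^ n) / of_nat n) \<le> (r ^ n - (- r) ^ n) / of_nat n" for n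
  proof (cases "even n")
    case False
    then have odd: "u ^ n - (- u) ^ n = 2 * u ^ n" "r ^ n - (- r) ^ n = 2 * r ^ n"
      by auto
    show ?thesis
      unfolding odd norm_divide by (simp add: norm_mult norm_power r_def)
  qed simp
  then have "norm (\<Sum>n. (u ^ n - (- u) ^ n) / of_nat n) \<le> (\<Sum>n. (r ^ n - (- r) ^ n) / of_nat n)"
    using d by (intro norm_suminf_le) (auto simp: sums_iff)
  then show ?thesis
    using c d by (simp add: sums_iff r_def)
qed

text \<open>
  The Schwarz function is the inverse sigmoid \<open>log (v/(2 - v))\<close> at \<open>v = F z\<close>. Writing it as a difference
  of principal logarithms keeps both arguments in the right half-plane, away from the branch cut.
\<close>

lemma subordinate_modified_sigmoidI:
  assumes F: "F holomorphic_on \<D>" "F 0 = 1"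
    and bd: "\<And>z. z \<in> \<D> \<Longrightarrow> norm (F z - 1) < (exp 1 - 1) / (exp 1 + 1)"
  shows "F \<prec>\<^sub>s modified_sigmoid"
proof -
  define \<rho> :: real where "\<rho> = (exp 1 - 1) / (exp 1 + 1)"
  have \<rho>: "0 < \<rho>" "\<rho> < 1"
    by (auto simp: \<rho>_def divide_simps add_pos_pos)
  have ln\<rho>: "ln (1 + \<rho>) - ln (1 - \<rho>) = 1"
  proof -
    have e: "1 + \<rho> = exp 1 * (1 - \<rho>)"
      using add_pos_pos[OF exp_gt_zero[of "1::real"] zero_less_one] by (simp add: \<rho>_def divide_simps)
    have "ln (1 + \<rho>) = 1 + ln (1 - \<rho>)"
      unfolding e using \<rho> by (subst ln_mult) auto
    then show ?thesis by simp
  qed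
  define w where "w = (\<lambda>z. Ln (F z) - Ln (2 - F z))"
  have bd': "norm (F z - 1) < 1" if "z \<in> \<D>" for z
    using bd[OF that] \<rho> by (simp add: \<rho>_def)
  have re: "Re (F z) > 0" "Re (2 - F z) > 0" if "z \<in> \<D>" for z
    using bd'[OF that] abs_Re_le_cmod[of "F z - 1"] by auto
  have "w holomorphic_on \<D>"
    unfolding w_def using re F
    by (intro holomorphic_intros) (force simp: complex_nonpos_Reals_iff)+
  moreover have "w z \<in> \<D>" if z: "z \<in> \<D>" for z
  proof -
    define s where "s = norm (F z - 1)"
    have s: "0 \<le> s" "s < \<rho>" using bd[OF z] by (auto simp: \<rho>_def s_def)
    have "norm (w z) \<le> ln (1 + s) - ln (1 - s)"
      using norm_Ln_diff_le[OF bd'[OF z]] by (simp add: w_def s_def)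
    also have "\<dots> < ln (1 + \<rho>) - ln (1 - \<rho>)"
      using s \<rho> by (intro diff_strict_mono) auto
    finally show ?thesis by (simp add: ln\<rho>)
  qed
  moreover have "w 0 = 0" by (simp add: w_def F)
  moreover have "F z = modified_sigmoid (w z)" if z: "z \<in> \<D>" for z
  proof -
    have nz: "F z \<noteq> 0" "2 - F z \<noteq> 0"
      using re[OF z] by (metis less_irrefl zero_complex.sel(1))+
    have "exp (- w z) = (2 - F z) / F z"
      using nz by (simp add: w_def exp_diff)
    then have "1 + exp (- w z) = 2 / F z"
      using nz by (simp add: field_simps)
    then show ?thesis
      by (simp add: modified_sigmoid_def)
  qed
  ultimately show ?thesis
    using F modified_sigmoid_holomorphic unfolding subordinate_def by blast
qed

text \<open>
  The excluded value is \<open>2/(1 + exp (-1))\<close>; every preimage of it under the sigmoid has real part \<open>1\<close>,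
  since the exponential is periodic in the imaginary direction only.
\<close>

lemma subordinate_modified_sigmoid_neq:
  assumes F: "F \<prec>\<^sub>s modified_sigmoid" and z: "z \<in> \<D>"
  shows "F z \<noteq> of_real (1 + (exp 1 - 1) / (exp 1 + 1))"
proof
  assume eq: "F z = of_real (1 + (exp 1 - 1) / (exp 1 + 1))"
  obtain v where v: "v ` \<D> \<subseteq> \<D>" "\<forall>z\<in>\<D>. F z = modified_sigmoid (v z)"
    using F unfolding subordinate_def by blast
  define w where "w = v z"
  have w: "norm w < 1" and Fw: "F z = 2 / (1 + exp (- w))"
    using v z unfolding w_def modified_sigmoid_def image_subset_iff by auto
  have ee: "exp 1 + 1 \<noteq> (0::complex)"
    by (metis add_pos_pos exp_gt_zero exp_of_real less_irrefl of_real_1 of_real_add of_real_eq_0_iff zero_less_one)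
  have "of_real (1 + (exp 1 - 1) / (exp 1 + 1)) = (2 * exp 1 / (exp 1 + 1) :: complex)"
    using ee by (simp add: field_simps exp_of_real[of 1, simplified, symmetric])
  with eq Fw have E: "2 / (1 + exp (- w)) = 2 * exp 1 / (exp 1 + 1)" by simp
  then have "1 + exp (- w) \<noteq> 0" using ee by auto
  then have "exp 1 + 1 = exp 1 * (1 + exp (- w))"
    using E ee by (simp add: field_simps)
  then have "exp 1 * exp (- w) = 1" by (simp add: algebra_simps)
  then have "exp (1 - w) = 1" by (simp add: exp_diff exp_minus field_simps)
  then have "Re w = 1"
    by (auto simp: exp_eq_1)
  then show False
    using w abs_Re_le_cmod[of w] by simp
qed

section \<open>The radius of a product class\<close>

text \<open>
  A sharp bound \<open>B\<close> on the logarithmic derivatives determines the radius as the point where \<open>B\<close> reaches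
  the radius of the disc about \<open>1\<close> inscribed in the sigmoid domain. Sharpness is needed only at
  the point \<open>R\<close>, where the logarithmic derivative of the extremal \<open>k\<close> must equal the bound in
  value and not merely in modulus, because only the real boundary points of the domain
  touch the inscribed disc.
\<close>

theorem is_radius_class_SG:
  fixes B :: "real \<Rightarrow> real"
  assumes \<F>: "\<And>f. f \<in> \<F> \<longleftrightarrow> (\<exists>h\<in>H. \<forall>z\<in>\<D>. f z = z * h z)"
    and hol: "\<And>h. h \<in> H \<Longrightarrow> h holomorphic_on \<D>"
    and one: "\<And>h. h \<in> H \<Longrightarrow> h 0 = 1"
    and nz: "\<And>h z. h \<in> H \<Longrightarrow> z \<in> \<D> \<Longrightarrow> h z \<noteq> 0"
    and bound: "\<And>h z. h \<in> H \<Longrightarrow> z \<in> \<D> \<Longrightarrow> norm (zlogderiv h z) \<le> B (norm z)"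
    and mono: "strict_mono_on {0..<1} B"
    and R: "0 < R" "R < 1" and BR: "B R = (exp 1 - 1) / (exp 1 + 1)"
    and k: "k \<in> H" "zlogderiv k (of_real R) = of_real (B R)"
  shows "is_radius class_SG \<F> R"
proof -
  \<comment> \<open>A dilation of \<open>f = z h\<close> is \<open>z\<close> times a dilation of \<open>h\<close>, so \<open>z f'/f\<close> is dilated as well.\<close>
  have dil: "(\<lambda>z. inverse (of_real r) * f (of_real r * z)) \<in> class_A \<and>
      (\<forall>z\<in>\<D>. fquot (\<lambda>z. z * deriv (\<lambda>z. inverse (of_real r) * f (of_real r * z)) z)
          (\<lambda>z. inverse (of_real r) * f (of_real r * z)) z = 1 + zlogderiv h (of_real r * z))"
    if h: "h \<in> H" and f: "\<And>z. z \<in> \<D> \<Longrightarrow> f z = z * h z" and r: "0 < r" "r < 1" for f h and r :: real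
  proof -
    have rD: "of_real r * z \<in> \<D>" if "z \<in> \<D>" for z :: complex
      using that r mult_strict_mono[of r 1 "norm z" 1] by (auto simp: norm_mult)
    define hr where "hr = (\<lambda>z. h (of_real r * z))"
    have holr: "hr holomorphic_on \<D>"
      using holomorphic_on_compose_gen[of "(*) (of_real r)" \<D> h \<D>] hol[OF h] rD
      by (auto simp: hr_def o_def image_subset_iff intro!: holomorphic_intros)
    have eq: "inverse (of_real r) * f (of_real r * z) = z * hr z" if "z \<in> \<D>" for z
      using f[OF rD[OF that]] r by (simp add: hr_def)
    have nzr: "hr z \<noteq> 0" if "z \<in> \<D>" for z
      using nz[OF h rD[OF that]] by (simp add: hr_def)
    have zl: "zlogderiv hr z = zlogderiv h (of_real r * z)" if "z \<in> \<D>" for z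
    proof -
      have "(h has_field_derivative deriv h (of_real r * z)) (at (of_real r * z))"
        using hol[OF h] rD[OF that] holomorphic_derivI by blast
      then have "(hr has_field_derivative deriv h (of_real r * z) * of_real r) (at z)"
        unfolding hr_def by (rule DERIV_chain2) (auto intro!: derivative_eq_intros)
      then show ?thesis
        by (simp add: zlogderiv_def DERIV_imp_deriv hr_def mult_ac)
    qed
    have "hr 0 = 1" by (simp add: hr_def one[OF h])
    then show ?thesis
      using class_AI[OF holr _ eq] fquot_deriv_eq_zlogderiv[OF holr nzr eq] zl by auto
  qed
  have "R \<in> radius_admissible class_SG \<F>"
    unfolding radius_admissible_def
  proof (intro CollectI conjI R ballI allI impI)
    fix f r assume f: "f \<in> \<F>" and r: "0 < r \<and> r < R"
    obtain h where h: "h \<in> H" and fh: "\<And>z. z \<in> \<D> \<Longrightarrow> f z = z * h z"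
      using f \<F> by blast
    let ?fr = "\<lambda>z. inverse (of_real r) * f (of_real r * z)"
    let ?q = "fquot (\<lambda>z. z * deriv ?fr z) ?fr"
    have A: "?fr \<in> class_A" and q: "\<And>z. z \<in> \<D> \<Longrightarrow> ?q z = 1 + zlogderiv h (of_real r * z)"
      using dil[OF h fh, of r] r R by auto
    have rD: "norm (of_real r * z) < R" if "z \<in> \<D>" for z :: complex
      using that r mult_strict_mono[of r R "norm z" 1] by (auto simp: norm_mult)
    have "?q \<prec>\<^sub>s modified_sigmoid"
    proof (rule subordinate_modified_sigmoidI)
      have "(\<lambda>z. zlogderiv h (of_real r * z)) holomorphic_on \<D>"
      proof -
        have "zlogderiv h holomorphic_on \<D>"
          unfolding zlogderiv_def using hol[OF h] nz[OF h] by (intro holomorphic_intros) auto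
        moreover have "of_real r * z \<in> \<D>" if "z \<in> \<D>" for z :: complex
          using rD[OF that] R by simp
        ultimately show ?thesis
          using holomorphic_on_compose_gen[of "(*) (of_real r)" \<D> "zlogderiv h" \<D>]
          by (auto simp: o_def image_subset_iff intro!: holomorphic_intros)
      qed
      then have "(\<lambda>z. 1 + zlogderiv h (of_real r * z)) holomorphic_on \<D>"
        by (intro holomorphic_intros)
      then show "?q holomorphic_on \<D>"
        by (rule holomorphic_transform) (simp only: q)
      show "?q 0 = 1" using q[of 0] by (simp add: zlogderiv_def)
      fix z :: complex assume z: "z \<in> \<D>"
      have "norm (?q z - 1) \<le> B (norm (of_real r * z))"
        using q[OF z] bound[OF h, of "of_real r * z"] rD[OF z] R by simp
      also have "\<dots> < B R"
        using strict_mono_onD[OF mono, of "norm (of_real r * z)" R] rD[OF z] R by simp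
      finally show "norm (?q z - 1) < (exp 1 - 1) / (exp 1 + 1)" by (simp add: BR)
    qed
    then show "?fr \<in> class_SG"
      using A by (simp add: class_SG_def starlike_class_def)
  qed
  moreover have "R' \<le> R" if R': "R' \<in> radius_admissible class_SG \<F>" for R'
  proof (rule ccontr)
    assume "\<not> R' \<le> R"
    then obtain r where r: "R < r" "r < R'" using dense by (metis not_le)
    have r1: "r < 1" using r R' by (auto simp: radius_admissible_def)
    define f where "f = (\<lambda>z. z * k z)"
    have f: "f \<in> \<F>" using k \<F> by (auto simp: f_def)
    let ?fr = "\<lambda>z. inverse (of_real r) * f (of_real r * z)"
    let ?q = "fquot (\<lambda>z. z * deriv ?fr z) ?fr"
    have "?fr \<in> class_SG"
      using R' f r R by (auto simp: radius_admissible_def)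
    then have sub: "?q \<prec>\<^sub>s modified_sigmoid"
      by (simp add: class_SG_def starlike_class_def)
    \<comment> \<open>The dilation by \<open>r\<close> sends this point of the disc to \<open>R\<close>.\<close>
    define x :: complex where "x = of_real (R / r)"
    have x: "x \<in> \<D>" using r R by (simp add: x_def norm_divide)
    have rx: "of_real r * x = of_real R" using r R by (simp add: x_def)
    have "?q x = 1 + zlogderiv k (of_real r * x)"
      using dil[OF k(1), of f r] x r R r1 by (simp add: f_def)
    also have "\<dots> = of_real (1 + (exp 1 - 1) / (exp 1 + 1))"
      by (simp only: rx k BR of_real_add of_real_1)
    finally show False
      using subordinate_modified_sigmoid_neq[OF sub x] by blast
  qed
  ultimately show ?thesis by (simp add: is_radius_def)
qed

section \<open>Extremal functions\<close>

lemma cayley_in_class_P: "(\<lambda>z. (1 + z) / (1 - z)) \<in> class_P"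
proof -
  have "Re ((1 + z) / (1 - z)) > 0" if "z \<in> \<D>" for z :: complex
  proof -
    have nz: "1 - z \<noteq> 0" using that by auto
    have "(norm z)\<^sup>2 < 1" using that by (simp add: abs_square_less_1)
    then have "Re (1 + z) * Re (1 - z) + Im (1 + z) * Im (1 - z) > 0"
      unfolding cmod_power2 by (simp add: power2_eq_square algebra_simps)
    then show ?thesis
      unfolding Re_divide' using nz by (intro divide_pos_pos) auto
  qed
  moreover have "(\<lambda>z. (1 + z) / (1 - z)) holomorphic_on \<D>"
    by (intro holomorphic_intros) auto
  ultimately show ?thesis by (auto simp: class_P_def)
qed

text \<open>This map is the average of the constant \<open>1\<close> and \<open>(1 + z)/(1 - z)\<close>.\<close>

lemma half_plane_map_in_class_P_half: "(\<lambda>z. 1 / (1 - z)) \<in> class_P_half"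
proof -
  have "Re (1 / (1 - z)) > 1 / 2" if z: "z \<in> \<D>" for z :: complex
  proof -
    have "Re ((1 + z) / (1 - z)) > 0"
      using cayley_in_class_P z by (auto simp: class_P_def)
    moreover have "1 / (1 - z) + 1 / (1 - z) = 1 + (1 + z) / (1 - z)"
      using z by (cases "z = 1") (auto simp: field_simps)
    from arg_cong[OF this, of Re]
    have "Re (1 / (1 - z)) + Re (1 / (1 - z)) = 1 + Re ((1 + z) / (1 - z))"
      by (simp only: plus_complex.sel one_complex.sel)
    ultimately show ?thesis by linarith
  qed
  moreover have "(\<lambda>z. 1 / (1 - z)) holomorphic_on \<D>"
    by (intro holomorphic_intros) auto
  ultimately show ?thesis
    by (force simp: class_P_half_def class_P_def)
qed

lemma zlogderiv_cayley:
  assumes z: "z \<in> \<D>"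
  shows "zlogderiv (\<lambda>z. (1 + z) / (1 - z)) z = 2 * z / (1 - z\<^sup>2)"
proof -
  have nz: "1 - z \<noteq> 0" "1 + z \<noteq> 0"
    using z by (auto simp: add_eq_0_iff)
  have "((\<lambda>z. (1 + z) / (1 - z)) has_field_derivative 2 / (1 - z)\<^sup>2) (at z)"
    using nz by (auto intro!: derivative_eq_intros simp: power2_eq_square field_simps)
  moreover have "1 - z\<^sup>2 = (1 - z) * (1 + z)"
    by (simp add: power2_eq_square algebra_simps)
  moreover have "z * (2 / (1 - z)\<^sup>2) / ((1 + z) / (1 - z)) = 2 * z / ((1 - z) * (1 + z))"
    using nz by (simp add: divide_simps power2_eq_square)
  ultimately show ?thesis
    by (simp add: zlogderiv_def DERIV_imp_deriv)
qed

lemma zlogderiv_half_plane_map: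
  assumes z: "z \<in> \<D>"
  shows "zlogderiv (\<lambda>z. 1 / (1 - z)) z = z / (1 - z)"
proof -
  have nz: "1 - z \<noteq> 0" using z by auto
  have "((\<lambda>z. 1 / (1 - z)) has_field_derivative 1 / (1 - z)\<^sup>2) (at z)"
    using nz by (auto intro!: derivative_eq_intros simp: power2_eq_square field_simps)
  moreover have "z * (1 / (1 - z)\<^sup>2) / (1 / (1 - z)) = z / (1 - z)"
    using nz by (simp add: divide_simps power2_eq_square)
  ultimately show ?thesis
    by (simp add: zlogderiv_def DERIV_imp_deriv)
qed

section \<open>Sharp radii of product classes\<close>

text \<open>
  Two factors have positive real part, with extremal \<open>(1 + z)/(1 - z)\<close>; the class of the third factor, its
  bound \<open>\<gamma>\<close> and its extremal \<open>d\<close> are left open, so that all three classes are instances.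
\<close>

theorem is_radius_triple_product:
  assumes \<F>: "\<And>f. f \<in> \<F> \<longleftrightarrow>
      (\<exists>p\<in>class_P. \<exists>q\<in>class_P. \<exists>s\<in>Q. \<forall>z\<in>\<D>. f z = z * (p z * q z * s z))"
    and Q: "Q \<subseteq> class_P"
    and bound: "\<And>s z. s \<in> Q \<Longrightarrow> z \<in> \<D> \<Longrightarrow> norm (zlogderiv s z) \<le> \<gamma> (norm z)"
    and mono: "mono_on {0..<1} \<gamma>"
    and R: "0 < R" "R < 1" and root: "4 * R / (1 - R\<^sup>2) + \<gamma> R = (exp 1 - 1) / (exp 1 + 1)"
    and d: "d \<in> Q" "zlogderiv d (of_real R) = of_real (\<gamma> R)"
  shows "is_radius class_SG \<F> R"
proof -
  define c :: "complex \<Rightarrow> complex" where "c = (\<lambda>z. (1 + z) / (1 - z))"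
  have c: "c \<in> class_P" using cayley_in_class_P by (simp add: c_def)
  define H where "H = {h. \<exists>p\<in>class_P. \<exists>q\<in>class_P. \<exists>s\<in>Q. h = (\<lambda>z. p z * q z * s z)}"
  have hol: "(\<lambda>z. p z * q z * s z) holomorphic_on \<D>"
    if "p \<in> class_P" "q \<in> class_P" "s \<in> Q" for p q s
    using that Q class_P_D(1) by (intro holomorphic_intros) auto
  have zl: "zlogderiv (\<lambda>z. p z * q z * s z) z = zlogderiv p z + zlogderiv q z + zlogderiv s z"
    if pqs: "p \<in> class_P" "q \<in> class_P" "s \<in> Q" and z: "z \<in> \<D>" for p q s z
  proof -
    note P = class_P_D[OF pqs(1)] class_P_D[OF pqs(2)] class_P_D[OF subsetD[OF Q pqs(3)]]
    have "zlogderiv (\<lambda>z. p z * q z * s z) z = zlogderiv (\<lambda>z. p z * q z) z + zlogderiv s z"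
      using P z by (intro zlogderiv_mult) (auto intro!: holomorphic_intros)
    moreover have "zlogderiv (\<lambda>z. p z * q z) z = zlogderiv p z + zlogderiv q z"
      using P z by (intro zlogderiv_mult) auto
    ultimately show ?thesis by simp
  qed
  show ?thesis
  proof (rule is_radius_class_SG[where H = H
        and B = "\<lambda>x. 2 * x / (1 - x\<^sup>2) + 2 * x / (1 - x\<^sup>2) + \<gamma> x"
        and k = "\<lambda>z. c z * c z * d z"])
    show "f \<in> \<F> \<longleftrightarrow> (\<exists>h\<in>H. \<forall>z\<in>\<D>. f z = z * h z)" for f
      unfolding \<F> H_def by fast
    fix h assume "h \<in> H"
    then obtain p q s where h: "h = (\<lambda>z. p z * q z * s z)"
      and pqs: "p \<in> class_P" "q \<in> class_P" "s \<in> Q" unfolding H_def by blast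
    have s: "s \<in> class_P" using pqs Q by blast
    show "h holomorphic_on \<D>" unfolding h using hol pqs by blast
    show "h 0 = 1" using pqs s by (simp add: h class_P_D(2))
    fix z assume z: "z \<in> \<D>"
    show "h z \<noteq> 0" using pqs s z by (simp add: h class_P_D(4))
    show "norm (zlogderiv h z) \<le>
        2 * norm z / (1 - (norm z)\<^sup>2) + 2 * norm z / (1 - (norm z)\<^sup>2) + \<gamma> (norm z)"
      unfolding h zl[OF pqs z]
      by (intro norm_triangle_le add_mono norm_zlogderiv_class_P bound pqs z)
  next
    show "strict_mono_on {0..<1} (\<lambda>x. 2 * x / (1 - x\<^sup>2) + 2 * x / (1 - x\<^sup>2) + \<gamma> x)"
    proof (rule strict_mono_onI)
      fix x y :: real assume xy: "x \<in> {0..<1}" "y \<in> {0..<1}" "x < y"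
      then have "x\<^sup>2 \<le> y\<^sup>2" "y\<^sup>2 < 1"
        by (auto intro!: power_mono simp: abs_square_less_1)
      then have "2 * x / (1 - x\<^sup>2) < 2 * y / (1 - y\<^sup>2)"
        using xy by (intro frac_less) auto
      moreover have "\<gamma> x \<le> \<gamma> y"
        using mono_onD[OF mono, of x y] xy by simp
      ultimately show "2 * x / (1 - x\<^sup>2) + 2 * x / (1 - x\<^sup>2) + \<gamma> x
          < 2 * y / (1 - y\<^sup>2) + 2 * y / (1 - y\<^sup>2) + \<gamma> y"
        by (intro add_less_le_mono add_strict_mono)
    qed
    show "2 * R / (1 - R\<^sup>2) + 2 * R / (1 - R\<^sup>2) + \<gamma> R = (exp 1 - 1) / (exp 1 + 1)"
      using root by (simp add: add_divide_distrib[symmetric])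
    show "(\<lambda>z. c z * c z * d z) \<in> H"
      using c d unfolding H_def by blast
    have RD: "complex_of_real R \<in> \<D>" using R by simp
    show "zlogderiv (\<lambda>z. c z * c z * d z) (of_real R)
        = of_real (2 * R / (1 - R\<^sup>2) + 2 * R / (1 - R\<^sup>2) + \<gamma> R)"
      unfolding zl[OF c c d(1) RD] using zlogderiv_cayley[OF RD] by (simp add: c_def d(2))
  qed (use R in auto)
qed

section \<open>Radii as roots of quadratics\<close>

section \<open>Radii as roots of quadratics\<close>

text \<open>
  The rationalised form of the positive root makes sense for \<open>a = 0\<close> too. Comparing \<open>R\<close> with a number \<open>x\<close>
  amounts to evaluating the quadratic at \<open>x\<close>, so numerical bounds on \<open>R\<close> require no bounds on the square root.
\<close>

lemma quadratic_root:
  fixes a b c :: real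
  assumes "a \<ge> 0" "b > 0" "c > 0"
  defines "R \<equiv> 2 * c / (b + sqrt (b\<^sup>2 + 4 * a * c))"
  shows "R > 0" "a * R\<^sup>2 + b * R = c"
    and "\<And>x. x \<ge> 0 \<Longrightarrow> a * x\<^sup>2 + b * x < c \<Longrightarrow> x < R"
    and "\<And>x. x \<ge> 0 \<Longrightarrow> c < a * x\<^sup>2 + b * x \<Longrightarrow> R < x"
proof -
  define s where "s = sqrt (b\<^sup>2 + 4 * a * c)"
  have s: "s \<ge> 0" "s\<^sup>2 = b\<^sup>2 + 4 * a * c"
    using assms by (auto simp: s_def)
  have R: "R = 2 * c / (b + s)" by (simp add: R_def s_def)
  have bs: "b + s > 0" using s assms by linarith
  show pos: "R > 0" unfolding R using bs \<open>c > 0\<close> by simp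
  have "(a * R\<^sup>2 + b * R) * (b + s)\<^sup>2 = a * (R * (b + s))\<^sup>2 + b * (R * (b + s)) * (b + s)"
    by (simp add: power2_eq_square algebra_simps)
  also have "R * (b + s) = 2 * c" using bs by (simp add: R)
  also have "a * (2 * c)\<^sup>2 + b * (2 * c) * (b + s) = c * (4 * a * c + 2 * b\<^sup>2 + 2 * b * s)"
    by (simp add: power2_eq_square algebra_simps)
  also have "\<dots> = c * (b + s)\<^sup>2"
    using s by (simp add: power2_eq_square algebra_simps)
  finally show root: "a * R\<^sup>2 + b * R = c" using bs by simp
  have mono: "a * x\<^sup>2 + b * x \<le> a * y\<^sup>2 + b * y" if "0 \<le> x" "x \<le> y" for x y
    using that assms by (intro add_mono mult_left_mono power_mono) auto
  show "x < R" if "x \<ge> 0" "a * x\<^sup>2 + b * x < c" for x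
    using mono[of R x] that root pos by linarith
  show "R < x" if "x \<ge> 0" "c < a * x\<^sup>2 + b * x" for x
    using mono[of x R] that root pos by linarith
qed

text \<open>
  Five correct digits are needed because \<open>0.0901\<close> is off from the second radius by almost the
  tolerance \<open>0.00005\<close>; the Taylor polynomial of degree \<open>8\<close> yields them.
\<close>

lemma exp_1_bounds: "exp 1 > (271826 / 100000 :: real)" "exp 1 < (271829 / 100000 :: real)"
proof -
  obtain t :: real where t: "\<bar>t\<bar> \<le> \<bar>1\<bar>" "exp 1 = (\<Sum>m<9. 1 ^ m / fact m) + exp t / fact 9 * 1 ^ 9"
    using Maclaurin_exp_le[of 1 9] by blast
  have "exp t \<le> exp 1" using t(1) by simp
  then have "exp t \<le> 3" using exp_le by linarith
  moreover have "exp t > 0" by simp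
  moreover have "exp 1 = (109601 / 40320 :: real) + exp t / 362880"
    using t(2) by (simp add: fact_numeral eval_nat_numeral lessThan_Suc)
  ultimately show "exp 1 > (271826 / 100000 :: real)" "exp 1 < (271829 / 100000 :: real)"
    by linarith+
qed

theorem theorem3p11:
  shows "let e = exp (1::real);
             R1 = 2 * (e - 1) / ((6 + 6 * e) + sqrt (40 + 64 * e + 40 * e\<^sup>2));
             R2 = 2 * (e - 1) / ((5 + 5 * e) + sqrt (25 + 42 * e + 33 * e\<^sup>2));
             R3 = 2 * (e - 1) / ((4 + 4 * e) + sqrt (20 + 24 * e + 20 * e\<^sup>2))
         in (is_radius class_SG class_G1 R1 \<and> \<bar>R1 - 0.0766\<bar> < 0.00005) \<and>
            (is_radius class_SG class_G2 R2 \<and> \<bar>R2 - 0.0901\<bar> < 0.00005) \<and>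
            (is_radius class_SG class_G3 R3 \<and> \<bar>R3 - 0.1140\<bar> < 0.00005)"
proof -
  define e where "e = exp (1::real)"
  define R1 where "R1 = 2 * (e - 1) / ((6 + 6 * e) + sqrt (40 + 64 * e + 40 * e\<^sup>2))"
  define R2 where "R2 = 2 * (e - 1) / ((5 + 5 * e) + sqrt (25 + 42 * e + 33 * e\<^sup>2))"
  define R3 where "R3 = 2 * (e - 1) / ((4 + 4 * e) + sqrt (20 + 24 * e + 20 * e\<^sup>2))"
  have e: "e > 271826 / 100000" "e < 271829 / 100000"
    using exp_1_bounds by (auto simp: e_def)
  have R1': "R1 = 2 * (e - 1) / ((6 + 6 * e) + sqrt ((6 + 6 * e)\<^sup>2 + 4 * (e - 1) * (e - 1)))"
    unfolding R1_def by (simp add: power2_eq_square algebra_simps)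
  have R2': "R2 = 2 * (e - 1) / ((5 + 5 * e) + sqrt ((5 + 5 * e)\<^sup>2 + 4 * (2 * e) * (e - 1)))"
    unfolding R2_def by (simp add: power2_eq_square algebra_simps)
  have R3': "R3 = 2 * (e - 1) / ((4 + 4 * e) + sqrt ((4 + 4 * e)\<^sup>2 + 4 * (e - 1) * (e - 1)))"
    unfolding R3_def by (simp add: power2_eq_square algebra_simps)
  \<comment> \<open>In this form the radii are positive roots of \<open>a R\<^sup>2 + b R = e - 1\<close>; for a numerical \<open>x\<close>,
      the sign of \<open>a x\<^sup>2 + b x - (e - 1)\<close> is linear arithmetic in \<open>e\<close>.\<close>
  note root1 = quadratic_root[of "e - 1" "6 + 6 * e" "e - 1", folded R1']
  note root2 = quadratic_root[of "2 * e" "5 + 5 * e" "e - 1", folded R2']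
  note root3 = quadratic_root[of "e - 1" "4 + 4 * e" "e - 1", folded R3']
  have b1: "0.07655 < R1" "R1 < 0.07665"
    by (rule root1(3) root1(4); use e in \<open>simp add: power2_eq_square field_simps\<close>)+
  have b2: "0.09005 < R2" "R2 < 0.09015"
    by (rule root2(3) root2(4); use e in \<open>simp add: power2_eq_square field_simps\<close>)+
  have b3: "0.11395 < R3" "R3 < 0.11405"
    by (rule root3(3) root3(4); use e in \<open>simp add: power2_eq_square field_simps\<close>)+
  have "is_radius class_SG class_G1 R1"
  proof (rule is_radius_triple_product[OF class_G1_iff order.refl, where d = "\<lambda>z. (1 + z) / (1 - z)"])
    show "norm (zlogderiv s z) \<le> 2 * norm z / (1 - (norm z)\<^sup>2)" if "s \<in> class_P" "z \<in> \<D>" for s z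
      using that by (rule norm_zlogderiv_class_P)
    show "mono_on {0..<1} (\<lambda>x::real. 2 * x / (1 - x\<^sup>2))"
      by (intro mono_onI frac_le) (auto intro!: power_mono simp: abs_square_less_1)
    have "1 - R1\<^sup>2 > 0" using b1 by (simp add: abs_square_less_1)
    then show "4 * R1 / (1 - R1\<^sup>2) + 2 * R1 / (1 - R1\<^sup>2) = (exp 1 - 1) / (exp 1 + 1)"
      using root1(2) e unfolding e_def[symmetric]
      by (simp add: add_divide_distrib[symmetric] frac_eq_eq) (simp add: algebra_simps)
    show "zlogderiv (\<lambda>z. (1 + z) / (1 - z)) (of_real R1) = of_real (2 * R1 / (1 - R1\<^sup>2))"
      using b1 by (simp add: zlogderiv_cayley)
  qed (use b1 cayley_in_class_P in auto)
  moreover have "is_radius class_SG class_G2 R2"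
  proof (rule is_radius_triple_product[OF class_G2_iff class_P_half_subset, where d = "\<lambda>z. 1 / (1 - z)"])
    show "norm (zlogderiv s z) \<le> norm z / (1 - norm z)" if "s \<in> class_P_half" "z \<in> \<D>" for s z
      using that by (rule norm_zlogderiv_class_P_half)
    show "mono_on {0..<1} (\<lambda>x::real. x / (1 - x))"
      by (intro mono_onI frac_le) auto
    \<comment> \<open>The common denominator \<open>1 - R2\<^sup>2\<close> turns the equation into \<open>2 e R2\<^sup>2 + 5 (1 + e) R2 = e - 1\<close>.\<close>
    have "R2 / (1 - R2) = (R2 + R2\<^sup>2) / (1 - R2\<^sup>2)"
    proof -
      have "R2 / (1 - R2) = (R2 * (1 + R2)) / ((1 - R2) * (1 + R2))"
        using b2 by simp
      then show ?thesis by (simp add: power2_eq_square algebra_simps)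
    qed
    moreover have "1 - R2\<^sup>2 > 0" using b2 by (simp add: abs_square_less_1)
    ultimately show "4 * R2 / (1 - R2\<^sup>2) + R2 / (1 - R2) = (exp 1 - 1) / (exp 1 + 1)"
      using root2(2) e unfolding e_def[symmetric]
      by (simp add: add_divide_distrib[symmetric] frac_eq_eq) (simp add: algebra_simps)
    show "zlogderiv (\<lambda>z. 1 / (1 - z)) (of_real R2) = of_real (R2 / (1 - R2))"
      using b2 by (simp add: zlogderiv_half_plane_map)
  qed (use b2 half_plane_map_in_class_P_half in auto)
  moreover have "is_radius class_SG class_G3 R3"
  proof (rule is_radius_triple_product[where Q = "{\<lambda>_. 1}" and \<gamma> = "\<lambda>_. 0" and d = "\<lambda>_. 1"])
    show "f \<in> class_G3 \<longleftrightarrow>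
        (\<exists>p\<in>class_P. \<exists>q\<in>class_P. \<exists>s\<in>{\<lambda>_. 1}. \<forall>z\<in>\<D>. f z = z * (p z * q z * s z))" for f
      by (simp add: class_G3_iff)
    have "1 - R3\<^sup>2 > 0" using b3 by (simp add: abs_square_less_1)
    then show "4 * R3 / (1 - R3\<^sup>2) + 0 = (exp 1 - 1) / (exp 1 + 1)"
      using root3(2) e unfolding e_def[symmetric]
      by (simp add: frac_eq_eq) (simp add: algebra_simps)
  qed (use b3 in \<open>auto simp: class_P_def zlogderiv_def intro!: mono_onI\<close>)
  ultimately show ?thesis
    unfolding Let_def e_def[symmetric] R1_def[symmetric] R2_def[symmetric] R3_def[symmetric]
    using b1 b2 b3 by (auto simp: abs_if)
qed

end
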